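(* For every $p\ge 1$, $$\|f\|_{2}\le 2\sqrt{\frac{2\pi}{p}}\,\|f\|_{\mathfrak{H}_{p}}$$ for every $f\in\mathfrak{X}$ (for every $f\in\mathfrak{X}\cap\mathfrak{H}_{1}$, if $p=1$).
   Context: $\mathcal{R}=\{z\in\mathbb{C}:\Re z>0\}$, and $\mathcal{H}(\mathcal{R})$ is the space of analytic functions on $\mathcal{R}$. $\|\cdot\|_{2}$ is the $L^{2}(0,1)$ norm. $\mathfrak{C}_{2}$ is the set of functions $f(x)=\int_{0}^{\infty}e^{-xt}\,d\sigma(t)$ with $\sigma$ a positive Borel-regular measure on $[0,\infty)$ such that $f(x)<\infty$ for all $x>0$ and $\|f\|_{2}<\infty$; such $f$ are regarded as analytic functions on $\mathcal{R}$ through the same formula. $\mathfrak{X}=\mathfrak{C}_{2}-\mathfrak{C}_{2}=\{f-g: f,g\in\mathfrak{C}_{2}\}$. $H=\{\phi\in H^{2}(\mathcal{R}):\overline{\phi(z)}=\phi(\bar z)\}$ is the real subspace of the Hardy space $H^2(\mathcal R)$, with norm $\|\phi\|^{2}=\sup_{x>0}\frac{1}{2\pi}\int_{\mathbb{R}}|\phi(x+iy)|^{2}dy$. For $p\ge 1$ and $f\in\mathcal{H}(\mathcal{R})$ let $$(\mathcal{F}_{p}[f])(z)=\frac{f(z^{1/p})}{z^{\frac{p-1}{2p}}(z^{1/p}+1)},\quad z\in\mathcal{R},$$ with principal branches of powers. Then $\mathfrak{H}_{p}=\{f\in\mathcal{H}(\mathcal{R}):\mathcal{F}_{p}[f]\in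 H\}$ with norm $\|f\|_{\mathfrak{H}_{p}}=\|\mathcal{F}_{p}[f]\|$. (For $p>1$ one has $\mathfrak{X}\subset\mathfrak{H}_p$.) *)

theory Defs
  imports "HOL-Complex_Analysis.Complex_Analysis"
begin

text \<open>
  Analytic functions on the right half-plane are represented by total functions of type
  \<^typ>\<open>complex \<Rightarrow> complex\<close>. Every notion below depends only on the values in the half-plane.
\<close>

definition right_half_plane :: "complex set" where
  "right_half_plane = {z. Re z > 0}"

definition sq_integrable01 :: "(complex \<Rightarrow> complex) \<Rightarrow> bool" where
  "sq_integrable01 f \<longleftrightarrow>
     set_integrable lborel {0<..<1} (\<lambda>x. (cmod (f (complex_of_real x)))\<^sup>2)"

definition L2_norm01 :: "(complex \<Rightarrow> complex) \<Rightarrow> real" where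
  "L2_norm01 f = sqrt (LINT x:{0<..<1}|lborel. (cmod (f (complex_of_real x)))\<^sup>2)"

text \<open>
  Regularity of the measure needs no separate clause: finiteness of the Laplace transform makes
  it finite on bounded sets, and such a Borel measure on the half-line is regular.
\<close>

definition C2 :: "(complex \<Rightarrow> complex) set" where
  "C2 = {f. \<exists>\<sigma> :: real measure.
           sets \<sigma> = sets (restrict_space borel {0..}) \<and>
           (\<forall>x>0. (\<integral>\<^sup>+ t. ennreal (exp (- x * t)) \<partial>\<sigma>) < \<infinity>) \<and>
           (\<forall>z\<in>right_half_plane. f z = (LINT t|\<sigma>. exp (- z * complex_of_real t))) \<and>
           sq_integrable01 f}"

definition X_space :: "(complex \<Rightarrow> complex) set" where
  "X_space = {\<lambda>z. f z - g z | f g. f \<in> C2 \<and> g \<in> C2}"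

definition hardy_norm_sq :: "(complex \<Rightarrow> complex) \<Rightarrow> ennreal" where
  "hardy_norm_sq \<phi> =
     (SUP x\<in>{0<..}. ennreal (1 / (2 * pi)) *
        (\<integral>\<^sup>+ y. ennreal ((cmod (\<phi> (Complex x y)))\<^sup>2) \<partial>lborel))"

text \<open>
  The real-valued norm is 0 when the supremum is infinite, so an upper bound in terms
  of it is never vacuous for functions outside the Hardy space.
\<close>

definition hardy_norm :: "(complex \<Rightarrow> complex) \<Rightarrow> real" where
  "hardy_norm \<phi> = sqrt (enn2real (hardy_norm_sq \<phi>))"

definition hardy_H2 :: "(complex \<Rightarrow> complex) set" where
  "hardy_H2 = {\<phi>. \<phi> holomorphic_on right_half_plane \<and> hardy_norm_sq \<phi> < \<infinity>}"

definition real_hardy_H2 :: "(complex \<Rightarrow> complex) set" where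
  "real_hardy_H2 = {\<phi> \<in> hardy_H2. \<forall>z\<in>right_half_plane. cnj (\<phi> z) = \<phi> (cnj z)}"

definition F_op :: "real \<Rightarrow> (complex \<Rightarrow> complex) \<Rightarrow> complex \<Rightarrow> complex" where
  "F_op p f z =
     f (z powr complex_of_real (1 / p)) /
     (z powr complex_of_real ((p - 1) / (2 * p)) * (z powr complex_of_real (1 / p) + 1))"

definition Hp_space :: "real \<Rightarrow> (complex \<Rightarrow> complex) set" where
  "Hp_space p = {f. f holomorphic_on right_half_plane \<and> F_op p f \<in> real_hardy_H2}"

definition Hp_norm :: "real \<Rightarrow> (complex \<Rightarrow> complex) \<Rightarrow> real" where
  "Hp_norm p f = hardy_norm (F_op p f)"

end

theory Submission
  imports Defs
begin

text \<open>
  Put \<open>\<phi> = F_p[f]\<close>. The substitution \<open>x = t\<^sup>p\<close> gives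
  \<open>\<integral>\<^sub>0\<^sup>\<infinity> \<bar>\<phi>(x)\<bar>\<^sup>2 dx = p \<integral>\<^sub>0\<^sup>\<infinity> \<bar>f(t)\<bar>\<^sup>2 / (1 + t)\<^sup>2 dt\<close>, and \<open>(1 + t)\<^sup>2 \<le> 4\<close> on the unit
  interval, so the theorem follows from an inequality of Fejer-Riesz type for the real Hardy space,
  \<open>\<integral>\<^sub>0\<^sup>\<infinity> \<bar>\<phi>(x)\<bar>\<^sup>2 dx \<le> 2 \<pi> \<parallel>\<phi>\<parallel>\<^sup>2\<close> (lemma \<open>half_line_integral_le\<close>).
  
  That inequality is Cauchy's theorem for \<open>\<phi>\<^sup>2\<close> on the rectangle \<open>[a, b] \<times> [0, Y]\<close>. On the bottom
  side \<open>\<phi>\<close> is real, so the integral there is the one to be estimated. On a vertical side the modulus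
  of \<open>\<phi>\<close> is even in the imaginary part, so the side contributes at most half of the integral over the
  full vertical line, that is \<open>\<pi> \<parallel>\<phi>\<parallel>\<^sup>2\<close>; the two sides together give the constant \<open>2 \<pi>\<close>. The top side
  is negligible for a suitable \<open>Y\<close>, because \<open>\<bar>\<phi>\<bar>\<^sup>2\<close> is integrable over the vertical strip.
  
  The argument needs \<open>\<phi>\<close> to lie in the Hardy space. For \<open>p = 1\<close> this is a hypothesis; for \<open>p > 1\<close> it
  is a property of Laplace transforms (lemma \<open>X_space_subset_Hp_space\<close>). A difference \<open>f = g - h\<close> of
  Laplace transforms of positive measures satisfies \<open>\<bar>f(z)\<bar> \<le> u(Re z)\<close>, where
  \<open>u(x) = \<bar>g(x)\<bar> + \<bar>h(x)\<bar>\<close> is decreasing on the half-line and square integrable near 0. The \<open>p\<close>-th root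
  of the half-plane is a sector of half-angle \<open>\<pi> / (2 p) < \<pi> / 2\<close>, in which the real part dominates
  \<open>c = cos (\<pi> / (2 p)) > 0\<close> times the modulus. Hence \<open>\<bar>\<phi>(z)\<bar>\<^sup>2 \<le> G(\<bar>z\<bar>)\<close> for an explicit
  decreasing \<open>G\<close>, so every vertical line integral is at most \<open>2 \<integral>\<^sub>0\<^sup>\<infinity> G\<close>, and the substitution
  \<open>x = t\<^sup>p\<close> shows that this is finite.
\<close>

section \<open>Laplace transforms of measures on the half-line\<close>

lemma open_right_half_plane: "open right_half_plane"
  unfolding right_half_plane_def by (rule open_halfspace_Re_gt)

lemma convex_right_half_plane: "convex right_half_plane"
  unfolding right_half_plane_def by (rule convex_halfspace_Re_gt)

locale laplace_measure =
  fixes \<sigma> :: "real measure"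
  assumes sets_eq: "sets \<sigma> = sets (restrict_space borel {0..})"
    and finite_transform: "x > 0 \<Longrightarrow> (\<integral>\<^sup>+ t. ennreal (exp (- x * t)) \<partial>\<sigma>) < \<infinity>"
begin

lemma space_nonneg: "t \<in> space \<sigma> \<Longrightarrow> 0 \<le> t"
  using sets_eq_imp_space_eq[OF sets_eq] by (simp add: space_restrict_space)

lemma borel_measurableI: "f \<in> borel_measurable borel \<Longrightarrow> f \<in> borel_measurable \<sigma>"
  by (subst measurable_cong_sets[OF sets_eq refl]) (rule measurable_restrict_space1)

lemma kernel_measurable: "(\<lambda>t. exp (- z * complex_of_real t)) \<in> borel_measurable \<sigma>"
  by (intro borel_measurableI borel_measurable_continuous_onI continuous_intros)

lemma integrable_real_kernel:
  assumes "x > 0"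
  shows "integrable \<sigma> (\<lambda>t. exp (- x * t))"
proof (rule integrableI_bounded)
  show "(\<lambda>t. exp (- x * t)) \<in> borel_measurable \<sigma>"
    by (intro borel_measurableI borel_measurable_continuous_onI continuous_intros)
  show "(\<integral>\<^sup>+ t. ennreal (norm (exp (- x * t))) \<partial>\<sigma>) < \<infinity>"
    using finite_transform[OF assms] by simp
qed

lemma integrable_kernel:
  assumes "Re z > 0"
  shows "integrable \<sigma> (\<lambda>t. exp (- z * complex_of_real t))"
  by (rule Bochner_Integration.integrable_bound[OF integrable_real_kernel[OF assms] kernel_measurable])
     auto

definition transform :: "complex \<Rightarrow> complex" where
  "transform z = (LINT t|\<sigma>. exp (- z * complex_of_real t))"

lemma transform_cnj: "cnj (transform z) = transform (cnj z)"
  unfolding transform_def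
  using Bochner_Integration.integral_cnj[of \<sigma> "\<lambda>t. exp (- z * complex_of_real t)"] by (simp add: exp_cnj)

text \<open>
  Positivity of the measure makes the transform decrease along the axis and dominate its values on
  the vertical line through each axis point.
\<close>

lemma norm_transform_le:
  assumes "0 < x" "x \<le> Re z"
  shows "cmod (transform z) \<le> cmod (transform (of_real x))"
proof -
  have "cmod (transform z) \<le> (LINT t|\<sigma>. cmod (exp (- z * complex_of_real t)))"
    unfolding transform_def by (rule integral_norm_bound)
  also have "\<dots> \<le> (LINT t|\<sigma>. exp (- x * t))"
  proof (rule integral_mono)
    show "integrable \<sigma> (\<lambda>t. cmod (exp (- z * complex_of_real t)))"
      using integrable_kernel[of z] assms by (intro integrable_norm) auto
    show "integrable \<sigma> (\<lambda>t. exp (- x * t))"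
      using assms by (intro integrable_real_kernel)
    show "cmod (exp (- z * complex_of_real t)) \<le> exp (- x * t)" if "t \<in> space \<sigma>" for t
      using assms space_nonneg[OF that] by (simp add: mult_right_mono)
  qed
  also have "\<dots> = Re (transform (of_real x))"
    unfolding transform_def
    using integral_of_real[of \<sigma> "\<lambda>t. exp (- x * t)", where 'a = complex]
    by (simp add: exp_of_real flip: of_real_mult of_real_minus)
  also have "\<dots> \<le> cmod (transform (of_real x))"
    by (rule complex_Re_le_cmod)
  finally show ?thesis .
qed

text \<open>
  The mean value inequality on the convex half-plane \<open>Re z \<ge> 2 c\<close>. The derivative of the kernel
  carries a factor \<open>t\<close>; half of the exponential decay is spent on absorbing it through
  \<open>c t \<le> exp (c t)\<close>, and what is left is still integrable.
\<close>

lemma kernel_lipschitz: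
  assumes "t \<ge> 0" "c > 0" "Re a \<ge> 2 * c" "Re b \<ge> 2 * c"
  shows "cmod (exp (- a * of_real t) - exp (- b * of_real t)) \<le> exp (- c * t) / c * cmod (a - b)"
proof (rule field_differentiable_bound)
  show "convex {z. Re z \<ge> 2 * c}" by (rule convex_halfspace_Re_ge)
  show "((\<lambda>z. exp (- z * of_real t)) has_field_derivative
          exp (- z * of_real t) * (- of_real t)) (at z within {z. Re z \<ge> 2 * c})" for z
    by (auto intro!: derivative_eq_intros)
  show "cmod (exp (- z * of_real t) * (- of_real t)) \<le> exp (- c * t) / c"
    if "z \<in> {z. Re z \<ge> 2 * c}" for z
  proof -
    have "cmod (exp (- z * of_real t) * (- of_real t)) \<le> exp (- (2 * c) * t) * t"
      using that assms(1) by (auto simp: norm_mult intro!: mult_right_mono)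
    also have "\<dots> = exp (- c * t) / c * (exp (- c * t) * (c * t))"
      using assms(2) by (simp add: field_simps flip: exp_add)
    also have "exp (- c * t) * (c * t) \<le> exp (- c * t) * exp (c * t)"
      using exp_ge_add_one_self[of "c * t"] by (intro mult_left_mono) (linarith, simp)
    also have "\<dots> = 1" by (simp flip: exp_add)
    finally show ?thesis using assms(2) by (simp add: divide_right_mono)
  qed
qed (use assms in auto)

text \<open>
  Differentiation under the integral sign, by dominated convergence of the difference quotients.
\<close>

lemma transform_has_field_derivative:
  assumes "Re z > 0"
  shows "(transform has_field_derivative
            (LINT t|\<sigma>. exp (- z * complex_of_real t) * (- of_real t))) (at z)"
proof -
  \<comment> \<open>On the disc of radius \<open>2 c = Re z / 2\<close> about \<open>z\<close> real parts stay above \<open>2 c\<close>, so one integrable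
    function dominates all difference quotients.\<close>
  define c where "c = Re z / 4"
  have c: "c > 0" using assms by (simp add: c_def)
  define S where "S = ball z (2 * c)"
  have ReS: "Re a \<ge> 2 * c" if "a \<in> S" for a
  proof -
    have "\<bar>Re (z - a)\<bar> < 2 * c"
      using that abs_Re_le_cmod[of "z - a"] unfolding S_def mem_ball dist_norm by linarith
    thus ?thesis unfolding c_def minus_complex.sel by linarith
  qed
  have zS: "z \<in> S" using c by (simp add: S_def)
  have int_c: "integrable \<sigma> (\<lambda>t. exp (- c * t) / c)"
    using integrable_real_kernel[OF c] by simp
  have "((\<lambda>a. (transform a - transform z) / (a - z)) \<longlongrightarrow>
           (LINT t|\<sigma>. exp (- z * complex_of_real t) * (- of_real t))) (at z within S)"
    unfolding tendsto_at_iff_sequentially comp_def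
  proof (intro allI impI)
    fix X :: "nat \<Rightarrow> complex"
    assume X: "\<forall>i. X i \<in> S - {z}" and lim: "X \<longlonglongrightarrow> z"
    let ?q = "\<lambda>i t. (exp (- X i * complex_of_real t) - exp (- z * of_real t)) / (X i - z)"
    have "(\<lambda>i. LINT t|\<sigma>. ?q i t) \<longlonglongrightarrow> (LINT t|\<sigma>. exp (- z * complex_of_real t) * (- of_real t))"
    proof (rule integral_dominated_convergence[OF _ _ int_c])
      show "(\<lambda>t. exp (- z * complex_of_real t) * (- of_real t)) \<in> borel_measurable \<sigma>"
        by (intro borel_measurableI borel_measurable_continuous_onI continuous_intros)
      show "?q i \<in> borel_measurable \<sigma>" for i
        using X by (intro borel_measurableI borel_measurable_continuous_onI continuous_intros) auto
      show "AE t in \<sigma>. (\<lambda>i. ?q i t) \<longlonglongrightarrow> exp (- z * complex_of_real t) * (- of_real t)"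
      proof (rule AE_I2)
        fix t
        have "((\<lambda>z. exp (- z * of_real t)) has_field_derivative
          exp (- z * of_real t) * (- of_real t)) (at z)"
          by (auto intro!: derivative_eq_intros)
        hence "((\<lambda>a. (exp (- a * of_real t) - exp (- z * of_real t)) / (a - z)) \<longlongrightarrow>
                 exp (- z * of_real t) * (- of_real t)) (at z)"
          by (simp add: has_field_derivative_iff)
        thus "(\<lambda>i. ?q i t) \<longlonglongrightarrow> exp (- z * complex_of_real t) * (- of_real t)"
          using X lim unfolding tendsto_at_iff_sequentially comp_def by auto
      qed
      show "AE t in \<sigma>. cmod (?q i t) \<le> exp (- c * t) / c" for i
      proof (rule AE_I2)
        fix t assume "t \<in> space \<sigma>"
        hence "t \<ge> 0" by (rule space_nonneg)
        from kernel_lipschitz[OF this c ReS ReS[OF zS], of "X i"] X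
        show "cmod (?q i t) \<le> exp (- c * t) / c"
          by (simp add: norm_divide divide_le_eq)
      qed
    qed
    moreover have "(LINT t|\<sigma>. ?q i t) = (transform (X i) - transform z) / (X i - z)" for i
    proof -
      have "Re (X i) > 0" using ReS[of "X i"] X c by fastforce
      from Bochner_Integration.integral_diff[OF integrable_kernel[OF this] integrable_kernel[OF assms]]
      show ?thesis unfolding transform_def by simp
    qed
    ultimately show "(\<lambda>i. (transform (X i) - transform z) / (X i - z)) \<longlonglongrightarrow>
        (LINT t|\<sigma>. exp (- z * complex_of_real t) * (- of_real t))"
      by (simp only:)
  qed
  moreover have "at z within S = at z"
    by (rule at_within_open[OF zS]) (simp add: S_def)
  ultimately show ?thesis by (simp add: has_field_derivative_iff)
qed

end

section \<open>Differences of square-integrable Laplace transforms\<close>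

lemma C2_E:
  assumes "f \<in> C2"
  obtains \<sigma> where "laplace_measure \<sigma>"
    "\<And>z. z \<in> right_half_plane \<Longrightarrow> f z = laplace_measure.transform \<sigma> z" "sq_integrable01 f"
proof -
  from assms obtain \<sigma> where "laplace_measure \<sigma>"
    "\<forall>z\<in>right_half_plane. f z = (LINT t|\<sigma>. exp (- z * complex_of_real t))" "sq_integrable01 f"
    unfolding C2_def laplace_measure_def by auto
  thus thesis using that by (simp add: laplace_measure.transform_def)
qed

lemma C2_holomorphic:
  assumes "f \<in> C2"
  shows "f holomorphic_on right_half_plane"
proof -
  from assms obtain \<sigma> where "laplace_measure \<sigma>"
    and eq: "\<And>z. z \<in> right_half_plane \<Longrightarrow> f z = laplace_measure.transform \<sigma> z" by (rule C2_E) blast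
  then interpret laplace_measure \<sigma> by simp
  have "transform holomorphic_on right_half_plane"
    using transform_has_field_derivative
    unfolding holomorphic_on_open[OF open_right_half_plane] by (auto simp: right_half_plane_def)
  thus ?thesis by (rule holomorphic_transform) (simp add: eq)
qed

lemma C2_cnj:
  assumes "f \<in> C2" "z \<in> right_half_plane"
  shows "cnj (f z) = f (cnj z)"
  using assms
  by (elim C2_E) (simp add: laplace_measure.transform_cnj right_half_plane_def)

lemma C2_norm_le:
  assumes "f \<in> C2" "0 < x" "x \<le> Re z"
  shows "cmod (f z) \<le> cmod (f (of_real x))"
  using assms
  by (elim C2_E) (simp add: laplace_measure.norm_transform_le right_half_plane_def)

lemma X_space_E:
  assumes "f \<in> X_space"
  obtains g h where "g \<in> C2" "h \<in> C2" "f = (\<lambda>z. g z - h z)"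
  using assms by (auto simp: X_space_def)

lemma X_space_holomorphic:
  assumes "f \<in> X_space"
  shows "f holomorphic_on right_half_plane"
  using assms by (elim X_space_E) (simp add: holomorphic_on_diff C2_holomorphic)

lemma X_space_cnj:
  assumes "f \<in> X_space" "z \<in> right_half_plane"
  shows "cnj (f z) = f (cnj z)"
  using assms by (elim X_space_E) (auto simp: C2_cnj)

lemma continuous_on_norm_of_real:
  assumes "f holomorphic_on right_half_plane"
  shows "continuous_on {0<..} (\<lambda>x. cmod (f (complex_of_real x)))"
  by (rule continuous_on_norm, rule continuous_on_compose2[OF holomorphic_on_imp_continuous_on[OF assms]])
     (auto simp: right_half_plane_def intro!: continuous_intros)

text \<open>
  The sum of the moduli of the two Laplace transforms on the axis serves as \<open>u\<close>: it is monotone,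
  whereas their difference \<open>f\<close> need not be, and it inherits their square integrability.
\<close>

lemma X_space_majorant:
  assumes "f \<in> X_space"
  obtains u :: "real \<Rightarrow> real" where "continuous_on {0<..} u"
    and "\<And>x. u x \<ge> 0"
    and "\<And>x y. 0 < x \<Longrightarrow> x \<le> y \<Longrightarrow> u y \<le> u x"
    and "\<And>x z. 0 < x \<Longrightarrow> x \<le> Re z \<Longrightarrow> cmod (f z) \<le> u x"
    and "set_integrable lborel {0<..<1} (\<lambda>x. (u x)\<^sup>2)"
proof -
  from assms obtain g h where gh: "g \<in> C2" "h \<in> C2" and f: "f = (\<lambda>z. g z - h z)"
    by (rule X_space_E)
  let ?u = "\<lambda>x. cmod (g (complex_of_real x)) + cmod (h (complex_of_real x))"
  show thesis
  proof (rule that[of ?u])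
    show cont: "continuous_on {0<..} ?u"
      using gh by (intro continuous_on_add continuous_on_norm_of_real C2_holomorphic)
    show "?u y \<le> ?u x" if "0 < x" "x \<le> y" for x y
      using that C2_norm_le[OF gh(1), of x "of_real y"] C2_norm_le[OF gh(2), of x "of_real y"] by simp
    show "cmod (f z) \<le> ?u x" if "0 < x" "x \<le> Re z" for x z
      unfolding f using that C2_norm_le[OF gh(1), of x z] C2_norm_le[OF gh(2), of x z]
        norm_triangle_ineq4[of "g z" "h z"] by simp
    have "sq_integrable01 g" "sq_integrable01 h"
      using gh by (auto elim: C2_E)
    hence int: "set_integrable lborel {0<..<1}
        (\<lambda>x. 2 * (cmod (g (complex_of_real x)))\<^sup>2 + 2 * (cmod (h (complex_of_real x)))\<^sup>2)"
      unfolding sq_integrable01_def by (intro set_integral_add set_integrable_mult_right)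
    show "set_integrable lborel {0<..<1} (\<lambda>x. (?u x)\<^sup>2)"
    proof (rule set_integrable_bound[OF int])
      have "continuous_on {0<..<1} (\<lambda>x. (?u x)\<^sup>2)"
        by (intro continuous_intros continuous_on_subset[OF cont]) auto
      thus "set_borel_measurable lborel {0<..<1} (\<lambda>x. (?u x)\<^sup>2)"
        using borel_measurable_continuous_on_indicator[of "{0<..<1::real}" "\<lambda>x. (?u x)\<^sup>2"]
        by (simp add: set_borel_measurable_def)
      have sq: "(a + b)\<^sup>2 \<le> 2 * a\<^sup>2 + 2 * b\<^sup>2" for a b :: real
        using zero_le_power2[of "a - b"] by (simp add: power2_eq_square algebra_simps)
      show "AE x in lborel. x \<in> {0<..<1} \<longrightarrow> norm ((?u x)\<^sup>2) \<le>
          norm (2 * (cmod (g (complex_of_real x)))\<^sup>2 + 2 * (cmod (h (complex_of_real x)))\<^sup>2)"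
        by (intro AE_I2) (simp add: sq)
    qed
  qed simp
qed

section \<open>Restricting Hardy space functions to the real axis\<close>

lemma nn_integral_even:
  fixes h :: "real \<Rightarrow> ennreal"
  assumes [measurable]: "h \<in> borel_measurable borel" and even: "\<And>y. h (- y) = h y"
  shows "(\<integral>\<^sup>+ y. h y \<partial>lborel) = 2 * (\<integral>\<^sup>+ y\<in>{0<..}. h y \<partial>lborel)"
proof -
  have "(\<integral>\<^sup>+ y. h y \<partial>lborel) = (\<integral>\<^sup>+ y. h y * indicator {0<..} y + h y * indicator {..<0} y \<partial>lborel)"
    using AE_lborel_singleton[of 0]
    by (intro nn_integral_cong_AE) (auto elim!: eventually_mono split: split_indicator)
  also have "\<dots> = (\<integral>\<^sup>+ y\<in>{0<..}. h y \<partial>lborel) + (\<integral>\<^sup>+ y\<in>{..<0}. h y \<partial>lborel)"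
    by (rule nn_integral_add) measurable
  also have "(\<integral>\<^sup>+ y\<in>{..<0}. h y \<partial>lborel) = (\<integral>\<^sup>+ y. h (0 + (-1) * y) * indicator {..<0} (0 + (-1) * y) \<partial>lborel)"
    using nn_integral_real_affine[of "\<lambda>y. h y * indicator {..<0} y" "-1" 0] by simp
  also have "\<dots> = (\<integral>\<^sup>+ y\<in>{0<..}. h y \<partial>lborel)"
    by (intro nn_integral_cong) (auto simp: even split: split_indicator)
  finally show ?thesis by (simp add: mult_2)
qed

text \<open>
  Cauchy's theorem enters only through the existence of a primitive: the sides of a rectangle are
  compared by means of the increments of that primitive along straight segments.
\<close>

lemma has_bochner_integral_along_segment:
  assumes deriv: "\<And>z. z \<in> right_half_plane \<Longrightarrow> (\<Phi> has_field_derivative g z) (at z)"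
    and cont: "continuous_on right_half_plane g"
    and "s \<le> t"
    and path: "\<And>r. s \<le> r \<Longrightarrow> r \<le> t \<Longrightarrow> a + of_real r * d \<in> right_half_plane"
  shows "has_bochner_integral lborel (\<lambda>r. indicator {s..t} r *\<^sub>R (d * g (a + of_real r * d)))
           (\<Phi> (a + of_real t * d) - \<Phi> (a + of_real s * d))"
proof (rule has_bochner_integral_FTC_Icc[OF \<open>s \<le> t\<close>])
  fix r assume r: "s \<le> r" "r \<le> t"
  have "((\<lambda>r. a + of_real r * d) has_vector_derivative d) (at r)"
    by (auto intro!: derivative_eq_intros)
  from field_vector_diff_chain_at[OF this deriv[OF path[OF r]]]
  show "((\<lambda>r. \<Phi> (a + of_real r * d)) has_vector_derivative d * g (a + of_real r * d))
          (at r within {s..t})"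
    by (auto simp: o_def intro: has_vector_derivative_at_within)
next
  show "continuous_on {s..t} (\<lambda>r. d * g (a + of_real r * d))"
    by (intro continuous_intros continuous_on_compose2[OF cont]) (auto simp: path)
qed

lemma primitive_increment_le:
  assumes deriv: "\<And>z. z \<in> right_half_plane \<Longrightarrow> (\<Phi> has_field_derivative g z) (at z)"
    and cont: "continuous_on right_half_plane g"
    and "s \<le> t" and "cmod d = 1"
    and path: "\<And>r. s \<le> r \<Longrightarrow> r \<le> t \<Longrightarrow> a + of_real r * d \<in> right_half_plane"
  shows "ennreal (cmod (\<Phi> (a + of_real t * d) - \<Phi> (a + of_real s * d)))
           \<le> (\<integral>\<^sup>+ r\<in>{s..t}. ennreal (cmod (g (a + of_real r * d))) \<partial>lborel)"
proof -
  note * = has_bochner_integral_along_segment[OF deriv cont \<open>s \<le> t\<close> path]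
  have "ennreal (cmod (\<Phi> (a + of_real t * d) - \<Phi> (a + of_real s * d)))
          \<le> (\<integral>\<^sup>+ r. ennreal (norm (indicator {s..t} r *\<^sub>R (d * g (a + of_real r * d)))) \<partial>lborel)"
    using has_bochner_integral_norm_bound[OF *] by simp
  also have "\<dots> = (\<integral>\<^sup>+ r\<in>{s..t}. ennreal (cmod (g (a + of_real r * d))) \<partial>lborel)"
    using \<open>cmod d = 1\<close> by (intro nn_integral_cong) (auto simp: norm_mult split: split_indicator)
  finally show ?thesis .
qed

lemma continuous_on_vertical:
  assumes "continuous_on right_half_plane f" "x > 0"
  shows "continuous_on UNIV (\<lambda>y. f (Complex x y))"
  by (rule continuous_on_compose2[OF assms(1)])
     (use assms(2) in \<open>auto simp: right_half_plane_def Complex_eq intro!: continuous_intros\<close>)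

lemma vertical_nn_integral_le:
  assumes "hardy_norm_sq \<phi> < \<infinity>" "x > 0"
  shows "(\<integral>\<^sup>+ y. ennreal ((cmod (\<phi> (Complex x y)))\<^sup>2) \<partial>lborel) \<le> ennreal (2 * pi * (hardy_norm \<phi>)\<^sup>2)"
proof -
  let ?I = "\<integral>\<^sup>+ y. ennreal ((cmod (\<phi> (Complex x y)))\<^sup>2) \<partial>lborel"
  have "ennreal (1 / (2 * pi)) * ?I \<le> hardy_norm_sq \<phi>"
    unfolding hardy_norm_sq_def using assms(2) by (intro SUP_upper) auto
  hence "ennreal (2 * pi) * (ennreal (1 / (2 * pi)) * ?I) \<le> ennreal (2 * pi) * hardy_norm_sq \<phi>"
    by (rule mult_left_mono) simp
  moreover have "ennreal (2 * pi) * (ennreal (1 / (2 * pi)) * ?I) = ?I"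
    by (simp flip: mult.assoc ennreal_mult)
  moreover have "hardy_norm_sq \<phi> = ennreal ((hardy_norm \<phi>)\<^sup>2)"
    using assms(1) by (simp add: hardy_norm_def)
  ultimately show ?thesis by (simp flip: ennreal_mult)
qed

text \<open>
  The symmetry \<open>\<phi>(cnj z) = cnj (\<phi> z)\<close> makes the modulus even along a vertical line, so the upper
  half carries exactly half of the integral.
\<close>

lemma half_vertical_nn_integral_le:
  assumes "\<phi> \<in> real_hardy_H2" "x > 0"
  shows "(\<integral>\<^sup>+ y\<in>{0<..}. ennreal ((cmod (\<phi> (Complex x y)))\<^sup>2) \<partial>lborel) \<le> ennreal (pi * (hardy_norm \<phi>)\<^sup>2)"
proof -
  let ?h = "\<lambda>y. ennreal ((cmod (\<phi> (Complex x y)))\<^sup>2)"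
  have hol: "\<phi> holomorphic_on right_half_plane" and fin: "hardy_norm_sq \<phi> < \<infinity>"
    and sym: "\<And>z. z \<in> right_half_plane \<Longrightarrow> cnj (\<phi> z) = \<phi> (cnj z)"
    using assms(1) by (auto simp: real_hardy_H2_def hardy_H2_def)
  have cont: "continuous_on UNIV (\<lambda>y. \<phi> (Complex x y))"
    by (rule continuous_on_vertical[OF holomorphic_on_imp_continuous_on[OF hol] assms(2)])
  have meas: "?h \<in> borel_measurable borel"
    by (intro measurable_compose[OF _ measurable_ennreal] borel_measurable_continuous_onI
          continuous_intros cont)
  have even: "?h (- y) = ?h y" for y
    using sym[of "Complex x y"] assms(2) complex_mod_cnj[of "\<phi> (Complex x y)"]
    by (simp add: right_half_plane_def complex_cnj)
  have "2 * (\<integral>\<^sup>+ y\<in>{0<..}. ?h y \<partial>lborel) = (\<integral>\<^sup>+ y. ?h y \<partial>lborel)"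
    by (rule nn_integral_even[OF meas even, symmetric])
  also have "\<dots> \<le> ennreal (2 * pi * (hardy_norm \<phi>)\<^sup>2)"
    by (rule vertical_nn_integral_le[OF fin assms(2)])
  also have "\<dots> = 2 * ennreal (pi * (hardy_norm \<phi>)\<^sup>2)"
    by (simp add: ennreal_mult' mult.assoc)
  finally show ?thesis by (simp add: ennreal_mult_le_mult_iff)
qed

lemma emeasure_lborel_Ioi: "emeasure lborel {a::real<..} = \<infinity>"
proof (rule ccontr)
  assume "emeasure lborel {a<..} \<noteq> \<infinity>"
  then obtain n where "emeasure lborel {a<..} < of_nat n"
    using ennreal_Ex_less_of_nat[of "emeasure lborel {a<..}"] by (auto simp: less_top)
  moreover have "emeasure lborel {a<..<a + real n} \<le> emeasure lborel {a<..}"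
    by (rule emeasure_mono) auto
  ultimately show False by (simp add: ennreal_of_nat_eq_real_of_nat)
qed

text \<open>
  By Tonelli, \<open>\<bar>\<phi>\<bar>\<^sup>2\<close> has finite integral over the strip \<open>a \<le> Re z \<le> b\<close>; if all horizontal integrals
  in the upper half were at least \<open>\<delta>\<close>, it would be infinite. This replaces any pointwise decay of
  \<open>\<phi>\<close> at infinity.
\<close>

lemma exists_small_horizontal_integral:
  assumes cont: "continuous_on right_half_plane \<phi>" and fin: "hardy_norm_sq \<phi> < \<infinity>"
    and ab: "0 < a" "a \<le> b" and "\<delta> > 0"
  obtains Y where "Y > 0"
    and "(\<integral>\<^sup>+ x\<in>{a..b}. ennreal ((cmod (\<phi> (Complex x Y)))\<^sup>2) \<partial>lborel) < ennreal \<delta>"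
proof -
  define F where "F = (\<lambda>p. ennreal (indicator ({a..b} \<times> UNIV) p *\<^sub>R (cmod (\<phi> (Complex (fst p) (snd p))))\<^sup>2))"
  have "continuous_on ({a..b} \<times> UNIV) (\<lambda>p. (cmod (\<phi> (Complex (fst p) (snd p))))\<^sup>2)"
    by (intro continuous_intros continuous_on_compose2[OF cont])
       (use ab in \<open>auto simp: right_half_plane_def Complex_eq intro!: continuous_intros\<close>)
  hence "(\<lambda>p. indicator ({a..b} \<times> UNIV) p *\<^sub>R (cmod (\<phi> (Complex (fst p) (snd p))))\<^sup>2) \<in> borel_measurable borel"
    by (intro borel_measurable_continuous_on_indicator borel_closed closed_Times) auto
  hence F_meas: "F \<in> borel_measurable (lborel \<Otimes>\<^sub>M lborel)"
    unfolding F_def lborel_prod by (intro measurable_compose[OF _ measurable_ennreal]) simp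
  have F_eq: "F (x, y) = ennreal ((cmod (\<phi> (Complex x y)))\<^sup>2) * indicator {a..b} x" for x y
    by (simp add: F_def split: split_indicator)
  have "(\<integral>\<^sup>+ y. \<integral>\<^sup>+ x. F (x, y) \<partial>lborel \<partial>lborel) = (\<integral>\<^sup>+ x. \<integral>\<^sup>+ y. F (x, y) \<partial>lborel \<partial>lborel)"
    by (rule lborel_pair.Fubini[OF F_meas])
  also have "\<dots> \<le> (\<integral>\<^sup>+ x. ennreal (2 * pi * (hardy_norm \<phi>)\<^sup>2) * indicator {a..b} x \<partial>lborel)"
    using ab by (intro nn_integral_mono)
      (auto simp: F_eq vertical_nn_integral_le[OF fin] split: split_indicator)
  also have "\<dots> < \<infinity>"
    using ab by (simp add: nn_integral_cmult ennreal_mult_less_top)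
  finally have finite: "(\<integral>\<^sup>+ y. \<integral>\<^sup>+ x. F (x, y) \<partial>lborel \<partial>lborel) < \<infinity>" .
  have "\<exists>Y>0. (\<integral>\<^sup>+ x. F (x, Y) \<partial>lborel) < ennreal \<delta>"
  proof (rule ccontr)
    assume "\<not> ?thesis"
    hence "ennreal \<delta> \<le> (\<integral>\<^sup>+ x. F (x, y) \<partial>lborel)" if "y > 0" for y
      using that by (meson not_less)
    hence lower: "ennreal \<delta> * indicator {0<..} y \<le> (\<integral>\<^sup>+ x. F (x, y) \<partial>lborel)" for y
      by (auto split: split_indicator)
    have "(\<integral>\<^sup>+ y. ennreal \<delta> * indicator {0::real<..} y \<partial>lborel) \<le> (\<integral>\<^sup>+ y. \<integral>\<^sup>+ x. F (x, y) \<partial>lborel \<partial>lborel)"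
      by (rule nn_integral_mono) (rule lower)
    moreover have "(\<integral>\<^sup>+ y. ennreal \<delta> * indicator {0::real<..} y \<partial>lborel) = \<infinity>"
      using \<open>\<delta> > 0\<close> by (simp add: nn_integral_cmult ennreal_mult_eq_top_iff emeasure_lborel_Ioi)
    ultimately show False using finite by simp
  qed
  thus thesis using that by (auto simp: F_eq)
qed

text \<open>
  Cauchy's theorem for \<open>\<phi>\<^sup>2\<close> on the rectangle \<open>[a, b] \<times> [0, Y]\<close>: each of the two vertical sides
  contributes at most \<open>\<pi>\<close> times the squared norm, and the top side at most \<open>\<delta>\<close>.
\<close>

lemma real_segment_integral_le:
  assumes \<phi>: "\<phi> \<in> real_hardy_H2" and ab: "0 < a" "a \<le> b"
  shows "(\<integral>\<^sup>+ x\<in>{a..b}. ennreal ((cmod (\<phi> (of_real x)))\<^sup>2) \<partial>lborel) \<le> ennreal (2 * pi * (hardy_norm \<phi>)\<^sup>2)"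
proof (rule ennreal_le_epsilon)
  fix \<delta> :: real assume "\<delta> > 0"
  have hol: "\<phi> holomorphic_on right_half_plane" and fin: "hardy_norm_sq \<phi> < \<infinity>"
    and sym: "\<And>z. z \<in> right_half_plane \<Longrightarrow> cnj (\<phi> z) = \<phi> (cnj z)"
    using \<phi> by (auto simp: real_hardy_H2_def hardy_H2_def)
  define g where "g = (\<lambda>z. (\<phi> z)\<^sup>2)"
  have hol_g: "g holomorphic_on right_half_plane"
    unfolding g_def by (intro holomorphic_intros hol)
  obtain \<Phi> where "\<And>z. z \<in> right_half_plane \<Longrightarrow> (\<Phi> has_field_derivative g z) (at z within right_half_plane)"
    using holomorphic_convex_primitive'[OF convex_right_half_plane open_right_half_plane hol_g] by blast
  hence \<Phi>: "(\<Phi> has_field_derivative g z) (at z)" if "z \<in> right_half_plane" for z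
    using that open_right_half_plane by (metis at_within_open)
  note cont_g = holomorphic_on_imp_continuous_on[OF hol_g]
  obtain Y where "Y > 0"
    and Y: "(\<integral>\<^sup>+ x\<in>{a..b}. ennreal ((cmod (\<phi> (Complex x Y)))\<^sup>2) \<partial>lborel) < ennreal \<delta>"
    using exists_small_horizontal_integral[OF holomorphic_on_imp_continuous_on[OF hol] fin ab \<open>\<delta> > 0\<close>]
    by blast
  \<comment> \<open>The bottom side: on the real axis \<open>\<phi>\<close> is real, so \<open>g = \<bar>\<phi>\<bar>\<^sup>2\<close> there.\<close>
  have g_real: "g (of_real x) = of_real ((cmod (\<phi> (of_real x)))\<^sup>2)" if "x > 0" for x
  proof -
    have "cnj (\<phi> (of_real x)) = \<phi> (of_real x)"
      using sym[of "of_real x"] that by (simp add: right_half_plane_def)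
    thus ?thesis
      using complex_norm_square[of "\<phi> (of_real x)"] by (simp add: g_def power2_eq_square)
  qed
  have "has_bochner_integral lborel (\<lambda>x. indicator {a..b} x *\<^sub>R (1 * g (0 + of_real x * 1)))
          (\<Phi> (0 + of_real b * 1) - \<Phi> (0 + of_real a * 1))"
    by (rule has_bochner_integral_along_segment[OF \<Phi> cont_g ab(2)])
       (use ab in \<open>auto simp: right_half_plane_def\<close>)
  hence "has_bochner_integral lborel
      (\<lambda>x. complex_of_real (indicator {a..b} x * (cmod (\<phi> (of_real x)))\<^sup>2)) (\<Phi> (of_real b) - \<Phi> (of_real a))"
    by (rule has_bochner_integral_cong[THEN iffD1, rotated -1])
       (use ab in \<open>auto simp: g_real split: split_indicator\<close>)
  hence int: "integrable lborel (\<lambda>x. indicator {a..b} x * (cmod (\<phi> (of_real x)))\<^sup>2)"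
    and eq: "complex_of_real (\<integral>x. indicator {a..b} x * (cmod (\<phi> (of_real x)))\<^sup>2 \<partial>lborel) = \<Phi> (of_real b) - \<Phi> (of_real a)"
    by (auto simp: has_bochner_integral_iff complex_of_real_integrable_eq simp del: of_real_mult of_real_power)
  have "(\<integral>\<^sup>+ x\<in>{a..b}. ennreal ((cmod (\<phi> (of_real x)))\<^sup>2) \<partial>lborel)
      = (\<integral>\<^sup>+ x. ennreal (indicator {a..b} x * (cmod (\<phi> (of_real x)))\<^sup>2) \<partial>lborel)"
    by (intro nn_integral_cong) (auto split: split_indicator)
  also have "\<dots> = ennreal (\<integral>x. indicator {a..b} x * (cmod (\<phi> (of_real x)))\<^sup>2 \<partial>lborel)"
    by (rule nn_integral_eq_integral[OF int]) simp
  also have "\<dots> = ennreal (cmod (\<Phi> (of_real b) - \<Phi> (of_real a)))"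
    by (subst eq[symmetric], subst norm_of_real, subst abs_of_nonneg) (auto intro!: integral_nonneg)
  also have "\<dots> \<le> ennreal (cmod (\<Phi> (Complex b Y) - \<Phi> (of_real b)) + cmod (\<Phi> (Complex a Y) - \<Phi> (of_real a))
                      + cmod (\<Phi> (Complex b Y) - \<Phi> (Complex a Y)))"
    by (intro ennreal_leI) norm
  also have "\<dots> = ennreal (cmod (\<Phi> (Complex b Y) - \<Phi> (of_real b))) + ennreal (cmod (\<Phi> (Complex a Y) - \<Phi> (of_real a)))
                      + ennreal (cmod (\<Phi> (Complex b Y) - \<Phi> (Complex a Y)))"
    by simp
  also have "\<dots> \<le> ennreal (pi * (hardy_norm \<phi>)\<^sup>2) + ennreal (pi * (hardy_norm \<phi>)\<^sup>2) + ennreal \<delta>"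
  proof (intro add_mono)
    have vertical: "ennreal (cmod (\<Phi> (Complex x Y) - \<Phi> (of_real x))) \<le> ennreal (pi * (hardy_norm \<phi>)\<^sup>2)"
      if "x > 0" for x
    proof -
      have "ennreal (cmod (\<Phi> (of_real x + of_real Y * \<i>) - \<Phi> (of_real x + of_real 0 * \<i>)))
              \<le> (\<integral>\<^sup>+ r\<in>{0..Y}. ennreal (cmod (g (of_real x + of_real r * \<i>))) \<partial>lborel)"
        by (rule primitive_increment_le[OF \<Phi> cont_g])
           (use that \<open>Y > 0\<close> in \<open>auto simp: right_half_plane_def\<close>)
      also have "\<dots> \<le> (\<integral>\<^sup>+ y\<in>{0<..}. ennreal ((cmod (\<phi> (Complex x y)))\<^sup>2) \<partial>lborel)"
        using AE_lborel_singleton[of 0]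
        by (intro nn_integral_mono_AE)
           (auto elim!: eventually_mono simp: g_def norm_power Complex_eq mult.commute split: split_indicator)
      also have "\<dots> \<le> ennreal (pi * (hardy_norm \<phi>)\<^sup>2)"
        by (rule half_vertical_nn_integral_le[OF \<phi> that])
      finally show ?thesis by (simp add: Complex_eq mult.commute)
    qed
    show "ennreal (cmod (\<Phi> (Complex b Y) - \<Phi> (of_real b))) \<le> ennreal (pi * (hardy_norm \<phi>)\<^sup>2)"
      "ennreal (cmod (\<Phi> (Complex a Y) - \<Phi> (of_real a))) \<le> ennreal (pi * (hardy_norm \<phi>)\<^sup>2)"
      using ab by (intro vertical; linarith)+
    have "ennreal (cmod (\<Phi> (\<i> * of_real Y + of_real b * 1) - \<Phi> (\<i> * of_real Y + of_real a * 1)))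
              \<le> (\<integral>\<^sup>+ r\<in>{a..b}. ennreal (cmod (g (\<i> * of_real Y + of_real r * 1))) \<partial>lborel)"
      by (rule primitive_increment_le[OF \<Phi> cont_g])
         (use ab in \<open>auto simp: right_half_plane_def\<close>)
    also have "\<dots> = (\<integral>\<^sup>+ x\<in>{a..b}. ennreal ((cmod (\<phi> (Complex x Y)))\<^sup>2) \<partial>lborel)"
      by (simp add: g_def norm_power Complex_eq add.commute)
    finally show "ennreal (cmod (\<Phi> (Complex b Y) - \<Phi> (Complex a Y))) \<le> ennreal \<delta>"
      using Y by (simp add: Complex_eq add.commute)
  qed
  also have "\<dots> = ennreal (2 * pi * (hardy_norm \<phi>)\<^sup>2) + ennreal \<delta>"
    by (simp flip: ennreal_plus)
  finally show "(\<integral>\<^sup>+ x\<in>{a..b}. ennreal ((cmod (\<phi> (of_real x)))\<^sup>2) \<partial>lborel)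
      \<le> ennreal (2 * pi * (hardy_norm \<phi>)\<^sup>2) + ennreal \<delta>" .
qed

text \<open>
  The bound on \<open>[a, b]\<close> does not depend on \<open>a\<close> and \<open>b\<close>, so monotone convergence over an exhaustion
  of the open half-line by compact intervals applies.
\<close>

lemma half_line_integral_le:
  assumes \<phi>: "\<phi> \<in> real_hardy_H2"
  shows "(\<integral>\<^sup>+ x\<in>{0<..}. ennreal ((cmod (\<phi> (of_real x)))\<^sup>2) \<partial>lborel) \<le> ennreal (2 * pi * (hardy_norm \<phi>)\<^sup>2)"
proof -
  have hol: "\<phi> holomorphic_on right_half_plane"
    using \<phi> by (auto simp: real_hardy_H2_def hardy_H2_def)
  define A where "A = (\<lambda>n. {inverse (real (Suc n))..real (Suc n)})"
  define h where "h = (\<lambda>n x. ennreal ((cmod (\<phi> (of_real x)))\<^sup>2) * indicator (A n) x)"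
  have A_pos: "x > 0" if "x \<in> A n" for x n
    using that by (auto simp: A_def intro: less_le_trans[rotated])
  have h_meas: "h n \<in> borel_measurable lborel" for n
  proof -
    have "continuous_on (A n) (\<lambda>x. (cmod (\<phi> (of_real x)))\<^sup>2)"
      by (intro continuous_intros continuous_on_subset[OF continuous_on_norm_of_real[OF hol]])
         (auto dest: A_pos)
    hence "(\<lambda>x. ennreal (indicator (A n) x *\<^sub>R (cmod (\<phi> (of_real x)))\<^sup>2)) \<in> borel_measurable borel"
      by (intro measurable_compose[OF _ measurable_ennreal] borel_measurable_continuous_on_indicator)
         (auto simp: A_def)
    moreover have "h n = (\<lambda>x. ennreal (indicator (A n) x *\<^sub>R (cmod (\<phi> (of_real x)))\<^sup>2))"
      by (auto simp: h_def split: split_indicator)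
    ultimately show ?thesis by simp
  qed
  have "incseq h"
  proof (rule incseq_SucI)
    fix n
    have "A n \<subseteq> A (Suc n)" by (auto simp: A_def field_simps)
    thus "h n \<le> h (Suc n)" by (auto simp: h_def le_fun_def split: split_indicator)
  qed
  have exhaust: "\<exists>n. x \<in> A n" if "x > 0" for x :: real
  proof -
    obtain n where n: "max x (inverse x) < real n" using reals_Archimedean2 by blast
    hence "inverse (real (Suc n)) \<le> inverse (inverse x)"
      using that by (intro le_imp_inverse_le) auto
    thus ?thesis using n by (auto simp: A_def intro!: exI[of _ n])
  qed
  have "(\<integral>\<^sup>+ x\<in>{0<..}. ennreal ((cmod (\<phi> (of_real x)))\<^sup>2) \<partial>lborel) \<le> (\<integral>\<^sup>+ x. (SUP n. h n x) \<partial>lborel)"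
  proof (rule nn_integral_mono)
    fix x :: real
    show "ennreal ((cmod (\<phi> (of_real x)))\<^sup>2) * indicator {0<..} x \<le> (SUP n. h n x)"
    proof (cases "x > 0")
      case True
      then obtain n where "x \<in> A n" using exhaust by blast
      thus ?thesis using True by (auto simp: h_def intro!: SUP_upper2[of n])
    qed auto
  qed
  also have "\<dots> = (SUP n. \<integral>\<^sup>+ x. h n x \<partial>lborel)"
    by (rule nn_integral_monotone_convergence_SUP[OF \<open>incseq h\<close> h_meas])
  also have "\<dots> \<le> ennreal (2 * pi * (hardy_norm \<phi>)\<^sup>2)"
    unfolding h_def A_def
    by (intro SUP_least real_segment_integral_le[OF \<phi>]) (auto simp: field_simps)
  finally show ?thesis .
qed

section \<open>The substitution by a power and weighted integrability\<close>

text \<open>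
  Both uses run from the transformed integrand, whose integrability is visible, back to \<open>h\<close>.
\<close>

lemma set_integrable_powr_substitution:
  fixes h :: "real \<Rightarrow> real"
  assumes "p > 0" and cont: "continuous_on {0<..} h" and nonneg: "\<And>x. x > 0 \<Longrightarrow> h x \<ge> 0"
    and int: "set_integrable lborel {0<..} (\<lambda>t. h (t powr p) * (p * t powr (p - 1)))"
  shows "set_integrable lborel {0<..} h"
    and "(LINT x:{0<..}|lborel. h x) = (LINT t:{0<..}|lborel. h (t powr p) * (p * t powr (p - 1)))"
proof -
  have deriv: "((\<lambda>t. t powr p) has_real_derivative p * t powr (p - 1)) (at t)"
    if "ereal 0 < ereal t" "ereal t < \<infinity>" for t
    using that by (intro has_real_derivative_powr) simp
  have cont_h: "isCont h (t powr p)" if "ereal 0 < ereal t" "ereal t < \<infinity>" for t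
    using that continuous_on_eq_continuous_at[of "{0<..}" h] cont by auto
  have cont_deriv: "isCont (\<lambda>t. p * t powr (p - 1)) t" if "ereal 0 < ereal t" "ereal t < \<infinity>" for t
    using that by (auto intro!: continuous_intros)
  have h_nonneg: "h (t powr p) \<ge> 0" if "ereal 0 < ereal t" "ereal t < \<infinity>" for t
    using that by (auto intro!: nonneg)
  have deriv_nonneg: "0 \<le> p * t powr (p - 1)" for t
    using \<open>p > 0\<close> by simp
  have "((\<lambda>t. t powr p) \<longlongrightarrow> 0) (at_right 0)"
    using \<open>p > 0\<close> by real_asymp
  hence lim_0: "((ereal \<circ> (\<lambda>t. t powr p) \<circ> real_of_ereal) \<longlongrightarrow> ereal 0) (at_right (ereal 0))"
    unfolding ereal_tendsto_simps by simp
  have "filterlim (\<lambda>t. t powr p) at_top at_top"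
    using \<open>p > 0\<close> by real_asymp
  hence lim_inf: "((ereal \<circ> (\<lambda>t. t powr p) \<circ> real_of_ereal) \<longlongrightarrow> \<infinity>) (at_left \<infinity>)"
    unfolding ereal_tendsto_simps by simp
  have int': "set_integrable lborel (einterval (ereal 0) \<infinity>) (\<lambda>t. h (t powr p) * (p * t powr (p - 1)))"
    using int by simp
  note substitution = interval_integral_substitution_nonneg
    [OF _ deriv cont_h cont_deriv h_nonneg deriv_nonneg lim_0 lim_inf int']
  show "set_integrable lborel {0<..} h"
    using substitution(1) by simp
  show "(LINT x:{0<..}|lborel. h x) = (LINT t:{0<..}|lborel. h (t powr p) * (p * t powr (p - 1)))"
    using substitution(2) by (simp add: interval_lebesgue_integral_def)
qed

lemma set_integrable_inverse_1_plus_square: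
  "set_integrable lborel {1..} (\<lambda>t::real. 1 / (1 + t\<^sup>2))"
proof -
  have "(\<integral>\<^sup>+ t. ennreal (1 / (1 + t\<^sup>2)) * indicator {1..} t \<partial>lborel) = ennreal (pi / 2 - arctan 1)"
  proof (rule nn_integral_FTC_atLeast[where F = arctan])
    show "(arctan has_real_derivative 1 / (1 + t\<^sup>2)) (at t)" for t
      using DERIV_arctan[of t] by (simp add: inverse_eq_divide)
  qed (auto intro: tendsto_arctan_at_top)
  moreover have "(\<integral>\<^sup>+ t. ennreal (norm (indicator {1..} t *\<^sub>R (1 / (1 + t\<^sup>2)) :: real)) \<partial>lborel)
      = (\<integral>\<^sup>+ t. ennreal (1 / (1 + t\<^sup>2)) * indicator {1..} t \<partial>lborel)"
    by (intro nn_integral_cong) (auto split: split_indicator)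
  ultimately have "(\<integral>\<^sup>+ t. ennreal (norm (indicator {1..} t *\<^sub>R (1 / (1 + t\<^sup>2)) :: real)) \<partial>lborel) < \<infinity>"
    by simp
  thus ?thesis
    unfolding set_integrable_def by (intro integrableI_bounded) auto
qed

text \<open>
  Near 0 the weight is harmless; beyond 1 the decreasing \<open>u\<close> is bounded by \<open>u 1\<close> and the weight alone
  is integrable.
\<close>

lemma set_integrable_decreasing_weighted:
  fixes u :: "real \<Rightarrow> real"
  assumes cont: "continuous_on {0<..} u" and nonneg: "\<And>x. u x \<ge> 0"
    and mono: "\<And>x y. 0 < x \<Longrightarrow> x \<le> y \<Longrightarrow> u y \<le> u x"
    and int: "set_integrable lborel {0<..<1} (\<lambda>x. (u x)\<^sup>2)"
  shows "set_integrable lborel {0<..} (\<lambda>t. (u t)\<^sup>2 / (1 + t\<^sup>2))"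
proof -
  have meas: "set_borel_measurable lborel A (\<lambda>t. (u t)\<^sup>2 / (1 + t\<^sup>2))"
    if "A \<in> sets borel" "A \<subseteq> {0<..}" for A
  proof -
    have "1 + t\<^sup>2 \<noteq> 0" for t :: real
      using zero_le_power2[of t] by linarith
    hence "continuous_on A (\<lambda>t. (u t)\<^sup>2 / (1 + t\<^sup>2))"
      by (intro continuous_intros continuous_on_subset[OF cont that(2)]) auto
    from borel_measurable_continuous_on_indicator[OF that(1) this] show ?thesis
      by (simp add: set_borel_measurable_def)
  qed
  have "set_integrable lborel {0<..<1} (\<lambda>t. (u t)\<^sup>2 / (1 + t\<^sup>2))"
  proof (rule set_integrable_bound[OF int meas])
    show "AE t in lborel. t \<in> {0<..<1} \<longrightarrow> norm ((u t)\<^sup>2 / (1 + t\<^sup>2)) \<le> norm ((u t)\<^sup>2)"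
      by (intro AE_I2) (auto simp: divide_le_eq add_pos_nonneg mult_le_cancel_left1)
  qed auto
  moreover have "set_integrable lborel {1..} (\<lambda>t. (u t)\<^sup>2 / (1 + t\<^sup>2))"
  proof (rule set_integrable_bound)
    show "set_integrable lborel {1..} (\<lambda>t. (u 1)\<^sup>2 * (1 / (1 + t\<^sup>2)))"
      by (intro set_integrable_mult_right set_integrable_inverse_1_plus_square)
    show "set_borel_measurable lborel {1..} (\<lambda>t. (u t)\<^sup>2 / (1 + t\<^sup>2))"
      by (rule meas) auto
    have "(u t)\<^sup>2 \<le> (u 1)\<^sup>2" if "t \<ge> 1" for t
      using that by (intro power_mono mono nonneg) auto
    thus "AE t in lborel. t \<in> {1..} \<longrightarrow> norm ((u t)\<^sup>2 / (1 + t\<^sup>2)) \<le> norm ((u 1)\<^sup>2 * (1 / (1 + t\<^sup>2)))"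
      by (intro AE_I2) (auto simp: divide_right_mono)
  qed
  ultimately have "set_integrable lborel ({0<..<1} \<union> {1..}) (\<lambda>t. (u t)\<^sup>2 / (1 + t\<^sup>2))"
    by (rule set_integrable_Un) auto
  moreover have "{0<..<1} \<union> {1..} = {0::real<..}" by auto
  ultimately show ?thesis by simp
qed

section \<open>The weighted composition operator\<close>

text \<open>
  The \<open>p\<close>-th root divides the argument by \<open>p\<close>, so it maps the half-plane into the sector of half-angle
  \<open>\<pi> / (2 p)\<close>.
\<close>

lemma Re_powr_inverse_ge:
  assumes "p \<ge> 1" "z \<in> right_half_plane"
  shows "cos (pi / (2 * p)) * cmod z powr (1 / p) \<le> Re (z powr complex_of_real (1 / p))"
    and "Re (z powr complex_of_real (1 / p)) > 0"
proof -
  have z: "z \<noteq> 0" "Re z > 0" using assms(2) by (auto simp: right_half_plane_def)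
  define \<theta> where "\<theta> = \<bar>Im (Ln z)\<bar> / p"
  have "\<bar>Im (Ln z)\<bar> < pi / 2" using Re_Ln_pos_lt[OF z(1)] z(2) by simp
  hence "\<theta> < (pi / 2) / p"
    unfolding \<theta>_def using assms(1) by (intro divide_strict_right_mono) auto
  hence \<theta>: "0 \<le> \<theta>" "\<theta> < pi / (2 * p)" using assms(1) by (auto simp: \<theta>_def)
  have half: "pi / (2 * p) \<le> pi / 2"
    using assms(1) by (simp add: field_simps)
  have "Re (z powr complex_of_real (1 / p)) = cmod z powr (1 / p) * cos (Im (Ln z) / p)"
    using z(1) by (simp add: powr_def Re_exp)
  also have "cos (Im (Ln z) / p) = cos \<theta>"
    using assms(1) by (simp add: \<theta>_def abs_if)
  finally have eq: "Re (z powr complex_of_real (1 / p)) = cmod z powr (1 / p) * cos \<theta>" .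
  have "cos (pi / (2 * p)) \<le> cos \<theta>"
    using \<theta> half pi_gt_zero by (intro cos_monotone_0_pi_le) linarith+
  thus "cos (pi / (2 * p)) * cmod z powr (1 / p) \<le> Re (z powr complex_of_real (1 / p))"
    unfolding eq by (subst mult.commute) (rule mult_left_mono, auto)
  have "cos \<theta> > 0" using \<theta> half by (intro cos_gt_zero_pi) linarith+
  thus "Re (z powr complex_of_real (1 / p)) > 0" unfolding eq using z by simp
qed

lemma norm_plus_1_ge:
  assumes "Re w \<ge> 0"
  shows "1 + (cmod w)\<^sup>2 \<le> (cmod (w + 1))\<^sup>2"
  using assms unfolding cmod_power2 by (simp add: power2_eq_square algebra_simps)

lemma F_op_holomorphic:
  assumes "p \<ge> 1" "f holomorphic_on right_half_plane"
  shows "F_op p f holomorphic_on right_half_plane"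
proof -
  have powr: "(\<lambda>z. z powr complex_of_real a) holomorphic_on right_half_plane" for a
    by (intro holomorphic_intros) (auto simp: right_half_plane_def complex_nonpos_Reals_iff)
  have "(f \<circ> (\<lambda>z. z powr complex_of_real (1 / p))) holomorphic_on right_half_plane"
    by (rule holomorphic_on_compose_gen[OF powr assms(2)])
       (use Re_powr_inverse_ge(2)[OF assms(1)] in \<open>auto simp: right_half_plane_def\<close>)
  moreover have "z powr complex_of_real ((p - 1) / (2 * p)) * (z powr complex_of_real (1 / p) + 1) \<noteq> 0"
    if "z \<in> right_half_plane" for z
  proof -
    have "Re (z powr complex_of_real (1 / p) + 1) \<noteq> 0"
      using Re_powr_inverse_ge(2)[OF assms(1) that] by simp
    hence "z powr complex_of_real (1 / p) + 1 \<noteq> 0" by (metis zero_complex.sel(1))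
    thus ?thesis using that by (auto simp: right_half_plane_def)
  qed
  ultimately show ?thesis
    unfolding F_op_def[abs_def] comp_def by (intro holomorphic_intros powr) auto
qed

lemma F_op_cnj:
  assumes "p \<ge> 1" and sym: "\<And>z. z \<in> right_half_plane \<Longrightarrow> cnj (f z) = f (cnj z)"
    and z: "z \<in> right_half_plane"
  shows "cnj (F_op p f z) = F_op p f (cnj z)"
proof -
  have powr: "cnj (z powr complex_of_real a) = cnj z powr complex_of_real a" for a
    using z by (subst cnj_powr) (auto simp: right_half_plane_def)
  have "z powr complex_of_real (1 / p) \<in> right_half_plane"
    using Re_powr_inverse_ge(2)[OF assms(1) z] by (simp add: right_half_plane_def)
  thus ?thesis
    unfolding F_op_def by (simp add: sym powr del: of_real_divide)
qed

lemma norm_F_op_sq: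
  assumes "z \<noteq> 0" "p > 0"
  shows "(cmod (F_op p f z))\<^sup>2 = cmod z powr (1 / p - 1) *
    ((cmod (f (z powr complex_of_real (1 / p))))\<^sup>2 / (cmod (z powr complex_of_real (1 / p) + 1))\<^sup>2)"
proof -
  have "(cmod (z powr complex_of_real ((p - 1) / (2 * p))))\<^sup>2 = cmod z powr (1 - 1 / p)"
    using assms by (simp add: norm_powr_real_powr' powr_power diff_divide_distrib del: of_real_divide)
  also have "\<dots> = inverse (cmod z powr (1 / p - 1))"
    by (simp flip: powr_minus)
  finally have "(cmod (z powr complex_of_real ((p - 1) / (2 * p))))\<^sup>2 = inverse (cmod z powr (1 / p - 1))" .
  thus ?thesis
    unfolding F_op_def norm_divide norm_mult power_divide power_mult_distrib
    by (simp only: divide_inverse inverse_mult_distrib inverse_inverse_eq mult_ac)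
qed

section \<open>Laplace transforms in the weighted Hardy spaces\<close>

text \<open>
  The pointwise bound \<open>u x = O(x powr (-1/2))\<close> near 0, which is all that monotonicity and square
  integrability give, would leave a logarithmically divergent integral. The square integrability of
  \<open>u\<close> itself has to be used, which is why the majorant \<open>G\<close> is kept in terms of \<open>u\<close> and integrated by
  substitution.
\<close>

lemma X_space_hardy_norm_finite:
  assumes p: "p > 1" and f: "f \<in> X_space"
  shows "hardy_norm_sq (F_op p f) < \<infinity>"
proof -
  from f obtain u where cont: "continuous_on {0<..} u" and nonneg: "\<And>x. u x \<ge> 0"
    and mono: "\<And>x y. 0 < x \<Longrightarrow> x \<le> y \<Longrightarrow> u y \<le> u x"
    and bound: "\<And>x z. 0 < x \<Longrightarrow> x \<le> Re z \<Longrightarrow> cmod (f z) \<le> u x"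
    and int: "set_integrable lborel {0<..<1} (\<lambda>x. (u x)\<^sup>2)"
    by (rule X_space_majorant) blast
  define c where "c = cos (pi / (2 * p))"
  have c: "0 < c" "c \<le> 1"
  proof -
    have "0 < pi / (2 * p)" "pi / (2 * p) < pi / 2" using p by (auto simp: field_simps)
    thus "0 < c" unfolding c_def by (intro cos_gt_zero) auto
  qed (simp add: c_def)
  \<comment> \<open>\<open>G (cmod z)\<close> is the formula for \<open>\<bar>F_p[f](z)\<bar>\<^sup>2\<close> with \<open>\<bar>f(w)\<bar>\<close> replaced by \<open>u (c \<bar>w\<bar>)\<close> and
    \<open>\<bar>w + 1\<bar>\<^sup>2\<close> by its lower bound \<open>1 + \<bar>w\<bar>\<^sup>2\<close>, where \<open>w\<close> is the \<open>p\<close>-th root of \<open>z\<close>.\<close>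
  define G where "G = (\<lambda>r. r powr (1 / p - 1) * ((u (c * r powr (1 / p)))\<^sup>2 / (1 + (r powr (1 / p))\<^sup>2)))"
  have sq_pos: "1 + t\<^sup>2 > 0" for t :: real
    using zero_le_power2[of t] by linarith
  hence sq_nz: "1 + t\<^sup>2 \<noteq> 0" for t :: real
    by (metis less_irrefl)
  have F_le_G: "(cmod (F_op p f z))\<^sup>2 \<le> G (cmod z)" if z: "z \<in> right_half_plane" for z
  proof -
    let ?w = "z powr complex_of_real (1 / p)"
    have "z \<noteq> 0" using z by (auto simp: right_half_plane_def)
    have norm_w: "cmod ?w = cmod z powr (1 / p)"
      by (simp add: norm_powr_real_powr' del: of_real_divide)
    have "cmod (f ?w) \<le> u (c * cmod z powr (1 / p))"
      using Re_powr_inverse_ge(1)[OF _ z, of p] p c \<open>z \<noteq> 0\<close> by (intro bound) (auto simp: c_def)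
    moreover have "1 + (cmod z powr (1 / p))\<^sup>2 \<le> (cmod (?w + 1))\<^sup>2"
      using norm_plus_1_ge[of ?w] Re_powr_inverse_ge(2)[OF _ z, of p] p by (simp only: norm_w) simp
    ultimately show ?thesis
      using \<open>z \<noteq> 0\<close> p sq_pos[of "cmod z powr (1 / p)"] unfolding G_def
      by (subst norm_F_op_sq) (auto intro!: mult_left_mono frac_le power_mono)
  qed
  have G_mono: "G s \<le> G r" if "0 < r" "r \<le> s" for r s
  proof -
    have "r powr (1 / p) \<le> s powr (1 / p)"
      using that p by (intro powr_mono2) auto
    moreover from this have "u (c * s powr (1 / p)) \<le> u (c * r powr (1 / p))"
      using c that by (intro mono mult_left_mono) auto
    moreover have "s powr (1 / p - 1) \<le> r powr (1 / p - 1)"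
      using that p by (intro powr_mono2') (auto simp: field_simps)
    ultimately show ?thesis
      unfolding G_def using sq_pos
      by (intro mult_mono frac_le power_mono add_left_mono divide_nonneg_nonneg) (auto simp: nonneg less_imp_le)
  qed
  \<comment> \<open>Rescaling by \<open>c\<close> changes the weight to \<open>1 + (c t)\<^sup>2\<close>; since \<open>c \<le> 1\<close>, the weight \<open>1 + t\<^sup>2\<close>
    gives a smaller integrand.\<close>
  have "integrable lborel (\<lambda>t. indicator {0<..} (0 + c * t) *\<^sub>R ((u (0 + c * t))\<^sup>2 / (1 + (0 + c * t)\<^sup>2)))"
    using set_integrable_decreasing_weighted[OF cont nonneg mono int] c
    unfolding set_integrable_def by (intro lborel_integrable_real_affine) auto
  moreover have "indicator {0<..} (0 + c * t) = (indicator {0<..} t :: real)" for t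
    using c by (auto simp: zero_less_mult_iff split: split_indicator)
  ultimately have scaled: "set_integrable lborel {0<..} (\<lambda>t. (u (c * t))\<^sup>2 / (1 + (c * t)\<^sup>2))"
    by (simp add: set_integrable_def)
  have cont_uc: "continuous_on {0<..} (\<lambda>t. u (c * t))"
    by (rule continuous_on_compose2[OF cont]) (use c in \<open>auto intro!: continuous_intros\<close>)
  have "set_integrable lborel {0<..} (\<lambda>t. p * ((u (c * t))\<^sup>2 / (1 + t\<^sup>2)))"
  proof (intro set_integrable_mult_right set_integrable_bound[OF scaled])
    have "continuous_on {0<..} (\<lambda>t. (u (c * t))\<^sup>2 / (1 + t\<^sup>2))"
      by (intro continuous_intros cont_uc) (simp_all add: sq_nz)
    from borel_measurable_continuous_on_indicator[OF _ this]
    show "set_borel_measurable lborel {0<..} (\<lambda>t. (u (c * t))\<^sup>2 / (1 + t\<^sup>2))"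
      by (simp add: set_borel_measurable_def)
    have "(c * t)\<^sup>2 \<le> t\<^sup>2" for t
      using c mult_right_mono[of "c\<^sup>2" 1 "t\<^sup>2"] by (simp add: power_mult_distrib power_le_one)
    thus "AE t in lborel. t \<in> {0<..} \<longrightarrow>
        norm ((u (c * t))\<^sup>2 / (1 + t\<^sup>2)) \<le> norm ((u (c * t))\<^sup>2 / (1 + (c * t)\<^sup>2))"
      using sq_pos by (intro AE_I2) (auto intro!: divide_left_mono simp: less_imp_le)
  qed
  moreover have "G (t powr p) * (p * t powr (p - 1)) = p * ((u (c * t))\<^sup>2 / (1 + t\<^sup>2))" if "t > 0" for t
  proof -
    have "(t powr p) powr (1 / p) = t" using that p by (simp add: powr_powr)
    moreover have "(t powr p) powr (1 / p - 1) * t powr (p - 1) = 1"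
      using that p by (simp add: powr_powr right_diff_distrib flip: powr_add)
    ultimately show ?thesis by (simp add: G_def)
  qed
  ultimately have G_subst: "set_integrable lborel {0<..} (\<lambda>t. G (t powr p) * (p * t powr (p - 1)))"
    by (subst set_integrable_cong[OF refl refl]) auto
  have G_cont: "continuous_on {0<..} G"
  proof -
    have "continuous_on {0<..} (\<lambda>r. u (c * r powr (1 / p)))"
      by (rule continuous_on_compose2[OF cont]) (use c in \<open>auto intro!: continuous_intros\<close>)
    thus ?thesis
      unfolding G_def by (intro continuous_intros) (simp_all add: sq_nz)
  qed
  have G_nonneg: "G r \<ge> 0" for r
    using sq_pos[of "r powr (1 / p)"] by (simp add: G_def)
  have G_int: "set_integrable lborel {0<..} G"
    using p by (intro set_integrable_powr_substitution(1)[OF _ G_cont G_nonneg G_subst]) simp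
  \<comment> \<open>\<open>G\<close> decreases and \<open>\<bar>y\<bar> \<le> \<bar>x + i y\<bar>\<close>, so the single function \<open>y \<mapsto> G \<bar>y\<bar>\<close> dominates on all
    vertical lines at once.\<close>
  define H where "H = (\<lambda>y. ennreal (indicator {0<..} \<bar>y\<bar> *\<^sub>R G \<bar>y\<bar>))"
  have G_meas: "(\<lambda>y. indicator {0<..} y *\<^sub>R G y) \<in> borel_measurable borel"
    using borel_measurable_integrable[OF G_int[unfolded set_integrable_def]] by simp
  have "(\<integral>\<^sup>+ y. H y \<partial>lborel) = 2 * (\<integral>\<^sup>+ y\<in>{0<..}. H y \<partial>lborel)"
  proof (rule nn_integral_even)
    show "H \<in> borel_measurable borel"
      unfolding H_def
      by (intro measurable_compose[OF _ measurable_ennreal] measurable_compose[OF _ G_meas]) simp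
  qed (simp add: H_def)
  also have "(\<integral>\<^sup>+ y\<in>{0<..}. H y \<partial>lborel) = (\<integral>\<^sup>+ y. ennreal (indicator {0<..} y *\<^sub>R G y) \<partial>lborel)"
    by (intro nn_integral_cong) (auto simp: H_def split: split_indicator)
  also have "\<dots> = ennreal (LINT y:{0<..}|lborel. G y)"
    using G_int unfolding set_integrable_def set_lebesgue_integral_def
    by (intro nn_integral_eq_integral) (auto simp: G_nonneg split: split_indicator)
  finally have H_fin: "(\<integral>\<^sup>+ y. H y \<partial>lborel) < \<infinity>"
    by (simp add: ennreal_mult_less_top)
  have "hardy_norm_sq (F_op p f) \<le> ennreal (1 / (2 * pi)) * (\<integral>\<^sup>+ y. H y \<partial>lborel)"
    unfolding hardy_norm_sq_def
  proof (intro SUP_least mult_left_mono nn_integral_mono_AE)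
    fix x :: real assume "x \<in> {0<..}"
    hence "(cmod (F_op p f (Complex x y)))\<^sup>2 \<le> G \<bar>y\<bar>" if "y \<noteq> 0" for y
      using that F_le_G[of "Complex x y"] G_mono[of "\<bar>y\<bar>" "cmod (Complex x y)"]
        abs_Im_le_cmod[of "Complex x y"] by (auto simp: right_half_plane_def)
    thus "AE y in lborel. ennreal ((cmod (F_op p f (Complex x y)))\<^sup>2) \<le> H y"
      using AE_lborel_singleton[of 0]
      by (auto elim!: eventually_mono simp: H_def intro!: ennreal_leI)
  qed simp
  also have "\<dots> < \<infinity>" using H_fin by (simp add: ennreal_mult_less_top)
  finally show ?thesis .
qed

lemma X_space_subset_Hp_space:
  assumes "p > 1" "f \<in> X_space"
  shows "f \<in> Hp_space p"
  using assms X_space_hardy_norm_finite[OF assms] F_op_cnj[of p f] X_space_cnj[OF assms(2)]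
  by (simp add: Hp_space_def real_hardy_H2_def hardy_H2_def X_space_holomorphic F_op_holomorphic)

section \<open>Comparison of the norms\<close>

theorem theorem5p3:
  fixes p :: real and f :: "complex \<Rightarrow> complex"
  assumes "p \<ge> 1"
    and "f \<in> X_space"
    and "p = 1 \<Longrightarrow> f \<in> Hp_space 1"
  shows "L2_norm01 f \<le> 2 * sqrt (2 * pi / p) * Hp_norm p f"
proof -
  have p: "p > 0" using assms(1) by simp
  have "f \<in> Hp_space p"
    using assms X_space_subset_Hp_space[of p f] by (cases "p = 1") auto
  define \<phi> where "\<phi> = F_op p f"
  have \<phi>: "\<phi> \<in> real_hardy_H2" using \<open>f \<in> Hp_space p\<close> by (simp add: Hp_space_def \<phi>_def)
  hence hol: "\<phi> holomorphic_on right_half_plane" by (simp add: real_hardy_H2_def hardy_H2_def)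
  have holf: "f holomorphic_on right_half_plane" by (rule X_space_holomorphic[OF assms(2)])
  let ?a = "\<lambda>t. (cmod (f (complex_of_real t)))\<^sup>2"
  let ?b = "\<lambda>x. (cmod (\<phi> (complex_of_real x)))\<^sup>2"
  from assms(2) obtain u where cont: "continuous_on {0<..} u" and nonneg: "\<And>x. u x \<ge> 0"
    and mono: "\<And>x y. 0 < x \<Longrightarrow> x \<le> y \<Longrightarrow> u y \<le> u x"
    and bound: "\<And>x z. 0 < x \<Longrightarrow> x \<le> Re z \<Longrightarrow> cmod (f z) \<le> u x"
    and int: "set_integrable lborel {0<..<1} (\<lambda>x. (u x)\<^sup>2)"
    by (rule X_space_majorant) blast
  have meas: "set_borel_measurable lborel A h"
    if "continuous_on {0<..} h" "A \<in> sets borel" "A \<subseteq> {0<..}" for A and h :: "real \<Rightarrow> real"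
    using borel_measurable_continuous_on_indicator[OF that(2) continuous_on_subset[OF that(1,3)]]
    by (simp add: set_borel_measurable_def)
  have cont_a: "continuous_on {0<..} ?a" and cont_b: "continuous_on {0<..} ?b"
    by (intro continuous_intros continuous_on_norm_of_real holf hol)+
  have a_le: "?a t \<le> (u t)\<^sup>2" if "t > 0" for t
    using that bound[of t "of_real t"] by (intro power_mono) auto
  have int_a: "set_integrable lborel {0<..<1} ?a"
    by (rule set_integrable_bound[OF int meas[OF cont_a]]) (auto simp: a_le)
  \<comment> \<open>Integrability on the whole half-line is needed to substitute; for \<open>t > 0\<close> the weight
    \<open>(1 + t)\<^sup>2\<close> exceeds \<open>1 + t\<^sup>2\<close>.\<close>
  have weighted: "set_integrable lborel {0<..} (\<lambda>t. p * (?a t / (1 + t)\<^sup>2))"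
  proof (intro set_integrable_mult_right
      set_integrable_bound[OF set_integrable_decreasing_weighted[OF cont nonneg mono int] meas])
    show "continuous_on {0<..} (\<lambda>t. ?a t / (1 + t)\<^sup>2)"
      by (intro continuous_intros cont_a) auto
    show "AE t in lborel. t \<in> {0<..} \<longrightarrow> norm (?a t / (1 + t)\<^sup>2) \<le> norm ((u t)\<^sup>2 / (1 + t\<^sup>2))"
      by (intro AE_I2) (auto intro!: frac_le a_le add_pos_nonneg simp: power2_sum)
  qed auto
  have weighted01: "set_integrable lborel {0<..<1} (\<lambda>t. p * (?a t / (1 + t)\<^sup>2))"
    by (rule set_integrable_subset[OF weighted]) auto
  \<comment> \<open>The factor \<open>z powr ((p - 1) / (2 p))\<close> in \<open>F_p\<close> is the square root of the Jacobian
    of \<open>x = t\<^sup>p\<close>, up to the constant \<open>p\<close>.\<close>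
  have subst: "?b (t powr p) * (p * t powr (p - 1)) = p * (?a t / (1 + t)\<^sup>2)" if "t > 0" for t
  proof -
    have root: "(t powr p) powr (1 / p) = t" using that p by (simp add: powr_powr)
    hence "complex_of_real (t powr p) powr complex_of_real (1 / p) = complex_of_real t"
      by (metis powr_of_real powr_ge_zero)
    moreover have "cmod (complex_of_real t + 1) = 1 + t"
      using that norm_of_real[of "t + 1", where 'a = complex] by simp
    ultimately have "?b (t powr p) = (t powr p) powr (1 / p - 1) * (?a t / (1 + t)\<^sup>2)"
      using that p norm_F_op_sq[of "complex_of_real (t powr p)" p f] unfolding \<phi>_def by simp
    hence "?b (t powr p) * (p * t powr (p - 1))
        = ((t powr p) powr (1 / p - 1) * t powr (p - 1)) * (p * (?a t / (1 + t)\<^sup>2))"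
      by simp
    also have "(t powr p) powr (1 / p - 1) * t powr (p - 1) = 1"
      using that p by (simp add: powr_powr right_diff_distrib flip: powr_add)
    finally show ?thesis by simp
  qed
  have weighted': "set_integrable lborel {0<..} (\<lambda>t. ?b (t powr p) * (p * t powr (p - 1)))"
    using weighted by (subst set_integrable_cong[OF refl refl subst]) auto
  note b = set_integrable_powr_substitution[OF p cont_b _ weighted']
  have "p / 4 * (LINT t:{0<..<1}|lborel. ?a t) = (LINT t:{0<..<1}|lborel. p * (?a t / 4))"
    by simp
  also have "\<dots> \<le> (LINT t:{0<..<1}|lborel. p * (?a t / (1 + t)\<^sup>2))"
  proof (rule set_integral_mono)
    show "set_integrable lborel {0<..<1} (\<lambda>t. p * (?a t / 4))"
      using int_a by simp
    show "set_integrable lborel {0<..<1} (\<lambda>t. p * (?a t / (1 + t)\<^sup>2))"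
      by (rule weighted01)
    fix t :: real assume t: "t \<in> {0<..<1}"
    hence "(1 + t)\<^sup>2 \<le> 2\<^sup>2" by (intro power_mono) auto
    thus "p * (?a t / 4) \<le> p * (?a t / (1 + t)\<^sup>2)"
      using p t by (intro mult_left_mono divide_left_mono) auto
  qed
  also have "\<dots> \<le> (LINT t:{0<..}|lborel. p * (?a t / (1 + t)\<^sup>2))"
    unfolding set_lebesgue_integral_def
    using p weighted weighted01
    by (intro integral_mono) (auto simp: set_integrable_def split: split_indicator)
  also have "\<dots> = (LINT t:{0<..}|lborel. ?b (t powr p) * (p * t powr (p - 1)))"
    by (rule set_lebesgue_integral_cong) (auto simp: subst)
  also have "\<dots> = (LINT x:{0<..}|lborel. ?b x)"
    by (rule b(2)[symmetric]) simp
  also have "\<dots> \<le> 2 * pi * (hardy_norm \<phi>)\<^sup>2"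
  proof -
    have "ennreal (LINT x:{0<..}|lborel. ?b x) = (\<integral>\<^sup>+ x. ennreal (indicator {0<..} x *\<^sub>R ?b x) \<partial>lborel)"
      using b(1) unfolding set_integrable_def set_lebesgue_integral_def
      by (intro nn_integral_eq_integral[symmetric]) auto
    also have "\<dots> = (\<integral>\<^sup>+ x\<in>{0<..}. ennreal (?b x) \<partial>lborel)"
      by (intro nn_integral_cong) (auto split: split_indicator)
    also have "\<dots> \<le> ennreal (2 * pi * (hardy_norm \<phi>)\<^sup>2)"
      by (rule half_line_integral_le[OF \<phi>])
    finally show ?thesis by simp
  qed
  finally have "(LINT t:{0<..<1}|lborel. ?a t) \<le> 4 * (2 * pi / p) * (hardy_norm \<phi>)\<^sup>2"
    using p by (simp add: field_simps)
  hence "L2_norm01 f \<le> sqrt (4 * (2 * pi / p) * (hardy_norm \<phi>)\<^sup>2)"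
    unfolding L2_norm01_def by (rule real_sqrt_le_mono)
  also have "\<dots> = 2 * sqrt (2 * pi / p) * hardy_norm \<phi>"
    unfolding real_sqrt_mult by (simp add: hardy_norm_def)
  finally show ?thesis by (simp add: Hp_norm_def \<phi>_def)
qed

end
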